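(* Let $M$ be a $1$-manifold with a basis $\mathcal{B}$ of open sets such that each $U\in\mathcal{B}$ is f-rim-simple. Then $NH(p)$ is discrete for each $p\in M$.
   Context: A $1$-manifold is a connected topological space each of whose points has a neighborhood homeomorphic to $\mathbb{R}$ (not assumed Hausdorff). Two points are separated if they have disjoint open neighborhoods; $NH(p)$ is the set of points $y\neq p$ of $M$ which cannot be separated from $p$. Let $U$ be an open Hausdorff subset of $M$ and $p\in\overline{U}\setminus U$. $U$ is f-simple at $p$ if for every open $V\ni p$ there is an open $W\subset V$ containing $p$ such that $W\cap U$ has finitely many connected components. $U$ is f-rim-simple if it is an open Hausdorff set that is f-simple at each point of $\overline{U}\setminus U$. *)

theory Defs
  imports "HOL-Analysis.Analysis"
begin

text \<open>A neighbourhood of \<open>p\<close> is a set with \<open>p\<close> in its interior; it need not be open.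
  Neither the Hausdorff property nor second countability is required.\<close>

definition one_manifold :: "'a topology \<Rightarrow> bool" where
  "one_manifold M \<longleftrightarrow> connected_space M \<and>
     (\<forall>p \<in> topspace M. \<exists>N \<subseteq> topspace M. p \<in> M interior_of N \<and>
        subtopology M N homeomorphic_space (euclidean :: real topology))"

definition separated_points :: "'a topology \<Rightarrow> 'a \<Rightarrow> 'a \<Rightarrow> bool" where
  "separated_points M x y \<longleftrightarrow>
     (\<exists>U V. openin M U \<and> openin M V \<and> x \<in> U \<and> y \<in> V \<and> disjnt U V)"

definition NH :: "'a topology \<Rightarrow> 'a \<Rightarrow> 'a set" where
  "NH M p = {y \<in> topspace M. y \<noteq> p \<and> \<not> separated_points M p y}"

text \<open>Only meaningful for \<open>U\<close> open and Hausdorff and \<open>p\<close> in the closure of \<open>U\<close> but not in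
  \<open>U\<close>; these conditions are imposed where the notion is used.\<close>

definition f_simple_at :: "'a topology \<Rightarrow> 'a set \<Rightarrow> 'a \<Rightarrow> bool" where
  "f_simple_at M U p \<longleftrightarrow>
     (\<forall>V. openin M V \<and> p \<in> V \<longrightarrow>
        (\<exists>W. openin M W \<and> W \<subseteq> V \<and> p \<in> W \<and>
             finite (connected_components_of (subtopology M (W \<inter> U)))))"

definition f_rim_simple :: "'a topology \<Rightarrow> 'a set \<Rightarrow> bool" where
  "f_rim_simple M U \<longleftrightarrow> openin M U \<and> Hausdorff_space (subtopology M U) \<and>
     (\<forall>p \<in> M closure_of U - U. f_simple_at M U p)"

end

theory Submission
  imports Defs
begin

text \<open>Take a basic open set \<open>U\<close> containing \<open>p\<close>. A point that cannot be separated from \<open>p\<close> is in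
  the closure of \<open>U\<close>, because all its neighbourhoods meet \<open>U\<close>, but it is not in \<open>U\<close>, because \<open>U\<close> is
  open and Hausdorff. So \<open>NH M p\<close> lies in the rim of \<open>U\<close> (\<open>NH_subset_rim\<close>), and it suffices that
  this rim is discrete.

  Near a rim point \<open>q\<close>, f-simplicity gives an open \<open>W\<close> around \<open>q\<close>, inside a chart, such that
  \<open>W \<inter> U\<close> has finitely many components. In the chart these are intervals of the
  line, and an interval has at most two boundary points. A rim point in \<open>W\<close> is in the closure of
  one of the finitely many components, hence is one of their end points; so only finitely many rim
  points lie in \<open>W\<close> (\<open>finite_rim_in_chart\<close>). As \<open>W\<close> is a T1 space, those other than \<open>q\<close>
  can be removed from it, which isolates \<open>q\<close>.\<close>

text \<open>There are at most two boundary points: one lying strictly between two others would be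
  interior to \<open>closure S\<close>, whose interior is that of \<open>S\<close> by convexity.\<close>

lemma finite_frontier_connected_real:
  fixes S :: "real set"
  assumes "connected S"
  shows "finite (frontier S)"
proof (rule ccontr)
  have "convex S"
    using assms is_interval_connected_1 is_interval_convex by blast
  have no_between: False
    if x: "x \<in> frontier S" and y: "y \<in> frontier S" and z: "z \<in> frontier S"
      and xyz: "x < y" "y < z" for x y z
  proof -
    have "{x..z} \<subseteq> closure S"
      using closed_segment_subset[OF _ _ convex_closure[OF \<open>convex S\<close>], of x z] x z xyz
      by (simp add: frontier_def closed_segment_eq_real_ivl)
    then have "interior {x..z} \<subseteq> interior (closure S)"
      by (rule interior_mono)
    then have "y \<in> interior S"
      using convex_interior_closure[OF \<open>convex S\<close>] xyz by auto
    then show False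
      using y by (simp add: frontier_def)
  qed
  assume "infinite (frontier S)"
  then obtain B where "B \<subseteq> frontier S" "card B = 3"
    using infinite_arbitrarily_large by blast
  then obtain x y z where "x \<in> frontier S" "y \<in> frontier S" "z \<in> frontier S"
    "x \<noteq> y" "y \<noteq> z" "x \<noteq> z"
    by (auto simp: card_3_iff)
  then show False
    using no_between by (metis linorder_neqE)
qed

lemma NH_subset_rim:
  assumes "openin M U" "Hausdorff_space (subtopology M U)" "p \<in> U"
  shows "NH M p \<subseteq> M closure_of U - U"
proof
  fix q assume q: "q \<in> NH M p"
  then have qM: "q \<in> topspace M" "q \<noteq> p" and nsep: "\<not> separated_points M p q"
    by (auto simp: NH_def)
  have "q \<in> M closure_of U"
    unfolding in_closure_of
  proof (intro conjI allI impI)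
    fix T assume "q \<in> T \<and> openin M T"
    then have "\<not> disjnt U T"
      using nsep assms unfolding separated_points_def by metis
    then show "\<exists>y. y \<in> U \<and> y \<in> T"
      by (auto simp: disjnt_iff)
  qed (use qM in simp)
  moreover have "q \<notin> U"
  proof
    assume "q \<in> U"
    moreover have "topspace (subtopology M U) = U"
      using openin_subset[OF assms(1)] by auto
    ultimately obtain A B where "openin (subtopology M U) A" "openin (subtopology M U) B"
      "p \<in> A" "q \<in> B" "disjnt A B"
      using assms(2,3) \<open>q \<noteq> p\<close> unfolding Hausdorff_space_def by metis
    then have "separated_points M p q"
      using openin_open_subtopology[OF assms(1)] unfolding separated_points_def by auto
    with nsep show False ..
  qed
  ultimately show "q \<in> M closure_of U - U" by blast
qed

text \<open>The rim points in \<open>W\<close> are mapped by the chart into the union of the frontiers of the images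
  of the components of \<open>W \<inter> U\<close>.\<close>

lemma finite_rim_in_chart:
  assumes "openin M W" "W \<subseteq> N" "N \<subseteq> topspace M"
    and chart: "subtopology M N homeomorphic_space (euclidean :: real topology)"
    and fin: "finite (connected_components_of (subtopology M (W \<inter> U)))"
  shows "finite (W \<inter> (M closure_of U - U))"
proof -
  define \<C> where "\<C> = connected_components_of (subtopology M (W \<inter> U))"
  obtain h :: "'a \<Rightarrow> real" where h: "homeomorphic_map (subtopology M N) euclidean h"
    using chart homeomorphic_space by blast
  have topN: "topspace (subtopology M N) = N"
    using assms by auto
  have cont: "continuous_map (subtopology M N) euclidean h" and inj: "inj_on h N"
    using homeomorphic_imp_continuous_map[OF h] homeomorphic_imp_injective_map[OF h] topN
    by simp_all
  have union: "\<Union>\<C> = W \<inter> U"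
    unfolding \<C>_def using assms by (auto simp: Union_connected_components_of)
  have "h ` (W \<inter> (M closure_of U - U)) \<subseteq> (\<Union>C\<in>\<C>. frontier (h ` C))"
  proof clarify
    fix x assume x: "x \<in> W" "x \<in> M closure_of U" "x \<notin> U"
    have "x \<in> M closure_of (\<Union>\<C>)"
      using openin_Int_closure_of_subset[OF assms(1), of U] x union by auto
    then obtain C where C: "C \<in> \<C>" "x \<in> M closure_of C"
      using fin closure_of_Union[of \<C> M] unfolding \<C>_def by blast
    have CN: "C \<subseteq> N"
      using C(1) union assms by blast
    have "x \<in> subtopology M N closure_of C"
      using C(2) CN x(1) \<open>W \<subseteq> N\<close>
      by (auto simp: closure_of_subtopology Int_absorb1)
    then have "h x \<in> closure (h ` C)"
      using continuous_map_image_closure_subset[OF cont] by auto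
    moreover have "h x \<notin> h ` C"
      using x C(1) CN union inj \<open>W \<subseteq> N\<close> by (auto dest!: inj_onD)
    ultimately show "h x \<in> (\<Union>C\<in>\<C>. frontier (h ` C))"
      using C(1) interior_subset by (auto simp: frontier_def)
  qed
  moreover have "finite (\<Union>C\<in>\<C>. frontier (h ` C))"
  proof (intro finite_UN_I finite_frontier_connected_real)
    show "finite \<C>" using fin by (simp add: \<C>_def)
    fix C assume "C \<in> \<C>"
    then have "connectedin (subtopology M (W \<inter> U)) C"
      unfolding \<C>_def by (rule connectedin_connected_components_of)
    then have "connectedin (subtopology M N) C"
      using \<open>W \<subseteq> N\<close> by (auto simp: connectedin_subtopology)
    then show "connected (h ` C)"
      using connectedin_continuous_map_image[OF cont] by auto
  qed
  ultimately have "finite (h ` (W \<inter> (M closure_of U - U)))"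
    by (rule finite_subset)
  then show ?thesis
    using inj \<open>W \<subseteq> N\<close> by (meson finite_imageD inf.coboundedI1 inj_on_subset)
qed

theorem corollary4p13:
  fixes M :: "'a topology" and \<B> :: "'a set set" and p :: 'a
  assumes "one_manifold M"
    and "openin M = arbitrary union_of (\<lambda>U. U \<in> \<B>)"
    and "\<And>U. U \<in> \<B> \<Longrightarrow> f_rim_simple M U"
    and "p \<in> topspace M"
  shows "subtopology M (NH M p) = discrete_topology (NH M p)"
proof -
  have "(arbitrary union_of (\<lambda>U. U \<in> \<B>)) (topspace M)"
    using assms(2) openin_topspace[of M] by simp
  then obtain \<U> where "\<U> \<subseteq> \<B>" "\<Union>\<U> = topspace M"
    unfolding union_of_def arbitrary_def by auto
  then obtain U where "U \<in> \<B>" "p \<in> U"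
    using assms(4) by blast
  then have U: "openin M U" "Hausdorff_space (subtopology M U)"
    and simple: "\<And>q. q \<in> M closure_of U - U \<Longrightarrow> f_simple_at M U q"
    using assms(3) unfolding f_rim_simple_def by blast+
  have rim: "NH M p \<subseteq> M closure_of U - U"
    using NH_subset_rim[OF U \<open>p \<in> U\<close>] .
  have "q \<notin> M derived_set_of NH M p" if q: "q \<in> NH M p" for q
  proof -
    obtain N where N: "N \<subseteq> topspace M" "q \<in> M interior_of N"
      "subtopology M N homeomorphic_space (euclidean :: real topology)"
      using assms(1) q unfolding one_manifold_def NH_def by blast
    obtain W where W: "openin M W" "W \<subseteq> M interior_of N" "q \<in> W"
      "finite (connected_components_of (subtopology M (W \<inter> U)))"
      using simple[of q] rim q N(2) unfolding f_simple_at_def by (meson openin_interior_of subsetD)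
    have WN: "W \<subseteq> N"
      using W(2) interior_of_subset by fastforce
    define F where "F = W \<inter> NH M p - {q}"
    have "finite F"
      using finite_rim_in_chart[OF W(1) WN N(1) N(3) W(4)] rim
      unfolding F_def by (auto elim: rev_finite_subset)
    have "t1_space (subtopology M N)"
      using homeomorphic_t1_space[OF N(3)] Hausdorff_space_euclidean Hausdorff_imp_t1_space by blast
    then have "t1_space (subtopology M W)"
      using WN t1_space_subtopology[of "subtopology M N" W]
      by (simp add: subtopology_subtopology Int_absorb1)
    moreover have topW: "topspace (subtopology M W) = W"
      using W(1) openin_subset by auto
    ultimately have "closedin (subtopology M W) F"
      using \<open>finite F\<close> unfolding t1_space_closedin_finite F_def by auto
    then have "openin (subtopology M W) (W - F)"
      unfolding closedin_def topW by blast
    then have "openin M (W - F)"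
      using openin_open_subtopology[OF W(1)] by blast
    moreover have "q \<in> W - F" and "\<not> (\<exists>y. y \<noteq> q \<and> y \<in> NH M p \<and> y \<in> W - F)"
      using \<open>q \<in> W\<close> by (auto simp: F_def)
    ultimately show ?thesis
      unfolding in_derived_set_of by metis
  qed
  then show ?thesis
    unfolding subtopology_eq_discrete_topology_eq disjoint_iff
    by (auto simp: NH_def)
qed

end
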